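(* Every Hadamard matrix over $\mathbb{F}_{2^r}$ that is an NMDS matrix is nonsingular.
   Context: A matrix $M$ of size $2^n\times 2^n$ over $\mathbb{F}_{2^r}$ is called a (finite field) Hadamard matrix if it has the form $M=\begin{bmatrix} U & V \\ V & U \end{bmatrix}$ where $U$ and $V$ are themselves Hadamard matrices (the recursion ending with arbitrary $1\times 1$ blocks). It is determined by its first row. An $[m,k]$ linear code is Near-MDS (NMDS) if its minimum distance is $m-k$ and its dual $[m,m-k]$ code has minimum distance $k$. A matrix $M$ of order $N$ is an NMDS matrix if $[I_N\,|\,M]$ is a generator matrix of a $[2N,N]$ NMDS code (i.e. the code and its dual both have minimum distance $N$).
   Formalization: The order 2^n is assumed to be at least 4 (n ≥ 2): the claim fails for order 1 with M = [0] and for order 2 with all four entries equal to some a ≠ 0, as both are NMDS Hadamard matrices and singular. *)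

theory Defs
  imports "Jordan_Normal_Form.VS_Connect" "HOL-Library.Cardinality"
begin

inductive hadamard_mat :: "nat \<Rightarrow> 'a::zero mat \<Rightarrow> bool" where
  base: "M \<in> carrier_mat 1 1 \<Longrightarrow> hadamard_mat 0 M"
| step: "hadamard_mat n U \<Longrightarrow> hadamard_mat n V \<Longrightarrow>
    hadamard_mat (Suc n) (four_block_mat U V V U)"

definition linear_code :: "nat \<Rightarrow> nat \<Rightarrow> 'a::field vec set \<Rightarrow> bool" where
  "linear_code m k C \<longleftrightarrow>
     subspace class_ring C (module_vec TYPE('a) m) \<and>
     vectorspace.dim class_ring ((module_vec TYPE('a) m)\<lparr>carrier := C\<rparr>) = k"

definition hamming_dist :: "'a vec \<Rightarrow> 'a vec \<Rightarrow> nat" where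
  "hamming_dist u v = card {i. i < dim_vec u \<and> u $ i \<noteq> v $ i}"

(* Unspecified for codes with fewer than two codewords. *)
definition min_dist :: "'a vec set \<Rightarrow> nat" where
  "min_dist C = (LEAST d. \<exists>u\<in>C. \<exists>v\<in>C. u \<noteq> v \<and> hamming_dist u v = d)"

definition dual_code :: "nat \<Rightarrow> 'a::field vec set \<Rightarrow> 'a vec set" where
  "dual_code m C = {v \<in> carrier_vec m. \<forall>c\<in>C. c \<bullet> v = 0}"

(* The dual of an [m,k] code is automatically an [m,m-k] code. *)
definition nmds_code :: "nat \<Rightarrow> nat \<Rightarrow> 'a::field vec set \<Rightarrow> bool" where
  "nmds_code m k C \<longleftrightarrow>
     linear_code m k C \<and> min_dist C = m - k \<and> min_dist (dual_code m C) = k"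

(* As C has dimension k, the k rows of a spanning G form a basis of C. *)
definition generator_mat :: "nat \<Rightarrow> nat \<Rightarrow> 'a::field mat \<Rightarrow> 'a vec set \<Rightarrow> bool" where
  "generator_mat m k G C \<longleftrightarrow>
     linear_code m k C \<and> G \<in> carrier_mat k m \<and> vec_space.row_space m G = C"

(* The block matrix [A | B]; the two lower blocks have no rows. *)
definition append_cols :: "'a::zero mat \<Rightarrow> 'a mat \<Rightarrow> 'a mat" where
  "append_cols A B = four_block_mat A B (0\<^sub>m 0 (dim_col A)) (0\<^sub>m 0 (dim_col B))"

definition nmds_mat :: "nat \<Rightarrow> 'a::field mat \<Rightarrow> bool" where
  "nmds_mat N M \<longleftrightarrow> M \<in> carrier_mat N N \<and>
     (\<exists>C. generator_mat (2 * N) N (append_cols (1\<^sub>m N) M) C \<and> nmds_code (2 * N) N C)"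

end

theory Submission
  imports Defs
begin

text \<open>
  In characteristic 2, Hadamard matrices of equal size commute, so the off-diagonal block
  \<open>UV + VU\<close> of \<open>M\<^sup>2\<close> vanishes and \<open>M\<^sup>2 = c I\<close> for a scalar \<open>c\<close>. If \<open>c \<noteq> 0\<close>, then \<open>M\<close> is
  invertible. If \<open>c = 0\<close>, then \<open>M\<close> squares to zero, and a combination of at most two unit vectors,
  or its image under the transpose of \<open>M\<close>, is a nonzero vector \<open>x\<close> with a zero coordinate and
  \<open>M\<^sup>T x = 0\<close>. The codeword \<open>(x, 0)\<close> then has weight less than the order of \<open>M\<close>, so \<open>M\<close> is not NMDS.
\<close>

text \<open>Translation by 1 permutes the field, so comparing the sum of all elements with its
  translate shows that the cardinality, read in the field, is 0. As it is a power of 2 and a field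
  has no zero divisors, 2 is 0.\<close>

lemma char_two_if_card_power_two:
  assumes "CARD('a::{field,finite}) = 2 ^ r"
  shows "(1::'a) + 1 = 0"
proof -
  have "(\<Sum>x\<in>(UNIV::'a set). x) = (\<Sum>x\<in>UNIV. x + 1)"
    by (rule sum.reindex_bij_witness[of _ "\<lambda>x. x + 1" "\<lambda>x. x - 1"]) auto
  also have "\<dots> = (\<Sum>x\<in>UNIV. x) + of_nat (CARD('a))"
    by (simp add: sum.distrib)
  finally have "(of_nat (CARD('a)) :: 'a) = 0"
    by simp
  then have "(2::'a) = 0"
    by (simp add: assms)
  then show ?thesis
    by simp
qed

lemma hadamard_mat_carrier:
  "hadamard_mat n M \<Longrightarrow> M \<in> carrier_mat (2 ^ n) (2 ^ n)"
proof (induction rule: hadamard_mat.induct)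
  case (step n U V)
  then show ?case
    using four_block_carrier_mat[OF step.IH(1) step.IH(1)] by (simp add: mult_2)
qed simp

text \<open>Induction on the block structure: once the smaller blocks commute, either product has
  diagonal blocks \<open>U * U' + V * V'\<close> and off-diagonal blocks
  \<open>U * V' + V * U'\<close>.\<close>

lemma hadamard_mat_commute:
  fixes A B :: "'a::comm_ring_1 mat"
  assumes "hadamard_mat n A" "hadamard_mat n B"
  shows "A * B = B * A"
  using assms
proof (induction n arbitrary: A B)
  case 0
  then have "A \<in> carrier_mat 1 1" "B \<in> carrier_mat 1 1"
    using hadamard_mat_carrier by force+
  then show ?case
    by (intro eq_matI) (auto simp: scalar_prod_def mult.commute)
next
  case (Suc n)
  obtain U V where A: "A = four_block_mat U V V U" "hadamard_mat n U" "hadamard_mat n V"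
    using Suc.prems(1) by (cases rule: hadamard_mat.cases) auto
  obtain U' V' where B: "B = four_block_mat U' V' V' U'" "hadamard_mat n U'" "hadamard_mat n V'"
    using Suc.prems(2) by (cases rule: hadamard_mat.cases) auto
  note c = A(2,3)[THEN hadamard_mat_carrier] B(2,3)[THEN hadamard_mat_carrier]
  have comm: "U * U' = U' * U" "U * V' = V' * U" "V * U' = U' * V" "V * V' = V' * V"
    using Suc.IH A B by auto
  \<comment> \<open>After rewriting with \<open>comm\<close>, the blocks can differ only in the
    order of their summands.\<close>
  have "U' * V + V' * U = V' * U + U' * V" "V' * V + U' * U = U' * U + V' * V"
    using c by (auto intro!: comm_add_mat[of _ "2 ^ n" "2 ^ n"])
  then show ?case
    using c comm
    by (simp add: A(1) B(1) mult_four_block_mat[where ?nr1.0 = "2 ^ n" and ?nr2.0 = "2 ^ n"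
          and ?n1.0 = "2 ^ n" and ?n2.0 = "2 ^ n" and ?nc1.0 = "2 ^ n" and ?nc2.0 = "2 ^ n"])
qed

lemma hadamard_mat_square_scalar:
  fixes M :: "'a::comm_ring_1 mat"
  assumes two: "(1::'a) + 1 = 0" and "hadamard_mat n M"
  shows "\<exists>c. M * M = c \<cdot>\<^sub>m 1\<^sub>m (2 ^ n)"
  using assms(2)
proof (induction rule: hadamard_mat.induct)
  case (base M)
  then have "M * M = (M $$ (0,0) * M $$ (0,0)) \<cdot>\<^sub>m 1\<^sub>m (2 ^ 0)"
    by (intro eq_matI) (auto simp: scalar_prod_def)
  then show ?case ..
next
  case (step n U V)
  obtain c d where cd: "U * U = c \<cdot>\<^sub>m 1\<^sub>m (2 ^ n)" "V * V = d \<cdot>\<^sub>m 1\<^sub>m (2 ^ n)"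
    using step.IH by auto
  note carr = step.hyps[THEN hadamard_mat_carrier]
  have dbl: "x + x = 0" for x :: 'a
    using two by (metis distrib_left mult.right_neutral mult_zero_right)
  \<comment> \<open>By commutativity both summands are the same matrix. Product entries stay folded
    so that each entry of the sum has the form \<open>x + x\<close>.\<close>
  have off: "U * V + V * U = 0\<^sub>m (2 ^ n) (2 ^ n)" "V * U + U * V = 0\<^sub>m (2 ^ n) (2 ^ n)"
    using hadamard_mat_commute[OF step.hyps] carr
    by (auto intro!: eq_matI simp: dbl simp del: index_mult_mat(1))
  have diag: "U * U + V * V = (c + d) \<cdot>\<^sub>m 1\<^sub>m (2 ^ n)" "V * V + U * U = (c + d) \<cdot>\<^sub>m 1\<^sub>m (2 ^ n)"
    by (auto simp: cd add_smult_distrib_right_mat[symmetric] add.commute intro!: eq_matI)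
  have "four_block_mat U V V U * four_block_mat U V V U
      = four_block_mat ((c + d) \<cdot>\<^sub>m 1\<^sub>m (2 ^ n)) (0\<^sub>m (2 ^ n) (2 ^ n))
          (0\<^sub>m (2 ^ n) (2 ^ n)) ((c + d) \<cdot>\<^sub>m 1\<^sub>m (2 ^ n))"
    using mult_four_block_mat[OF carr carr(2,1) carr carr(2,1)] by (simp add: off diag)
  also have "\<dots> = (c + d) \<cdot>\<^sub>m 1\<^sub>m (2 ^ Suc n)"
    by (intro eq_matI) auto
  finally show ?case ..
qed

lemma invertible_mat_if_square_scalar:
  fixes M :: "'a::field mat"
  assumes M: "M \<in> carrier_mat N N" and sq: "M * M = c \<cdot>\<^sub>m 1\<^sub>m N" and "c \<noteq> 0"
  shows "invertible_mat M"
proof -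
  have "M * (inverse c \<cdot>\<^sub>m M) = 1\<^sub>m N" "(inverse c \<cdot>\<^sub>m M) * M = 1\<^sub>m N"
    using mult_smult_distrib[OF M M] mult_smult_assoc_mat[OF M M] \<open>c \<noteq> 0\<close>
    by (auto simp: sq intro!: eq_matI)
  then show ?thesis
    using M unfolding invertible_mat_def inverts_mat_def by auto
qed

text \<open>Take a nonzero \<open>x\<close> supported on coordinates 0 and 1 and orthogonal to row 0
  of \<open>A\<close>. If \<open>A\<close> kills \<open>x\<close>, the zero coordinate is 2, which
  exists as \<open>N \<ge> 3\<close>. Otherwise the image of \<open>x\<close> is nonzero, vanishes
  at coordinate 0, and is killed because \<open>A\<close> squares to zero.\<close>

lemma square_zero_mat_kernel:
  fixes A :: "'a::comm_ring_1 mat"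
  assumes A: "A \<in> carrier_mat N N" and sq: "A * A = 0\<^sub>m N N" and N: "N \<ge> 3"
  shows "\<exists>x\<in>carrier_vec N. x \<noteq> 0\<^sub>v N \<and> A *\<^sub>v x = 0\<^sub>v N \<and> (\<exists>j<N. x $ j = 0)"
proof -
  have *: ?thesis
    if x: "x \<in> carrier_vec N" "x \<noteq> 0\<^sub>v N" "x $ 2 = 0" "(A *\<^sub>v x) $ 0 = 0" for x
  proof (cases "A *\<^sub>v x = 0\<^sub>v N")
    case True
    then show ?thesis using x N by (intro bexI[of _ x] conjI exI[of _ 2]) auto
  next
    case False
    have "A *\<^sub>v (A *\<^sub>v x) = 0\<^sub>m N N *\<^sub>v x"
      using assoc_mult_mat_vec[OF A A x(1)] sq by simp
    also have "\<dots> = 0\<^sub>v N"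
      using x(1) by (intro eq_vecI) auto
    finally have "A *\<^sub>v (A *\<^sub>v x) = 0\<^sub>v N" .
    then show ?thesis
      using False x N A
      by (intro bexI[of _ "A *\<^sub>v x"] conjI exI[of _ 0] mult_mat_vec_carrier[OF A]) auto
  qed
  \<comment> \<open>The first two entries of row 0, swapped and with one sign changed, are
    orthogonal to that row. If both are zero, the first unit vector serves instead.\<close>
  define x where "x = vec N (\<lambda>i. if i = 0 then A $$ (0,1) else if i = 1 then - A $$ (0,0) else 0)"
  show ?thesis
  proof (cases "x = 0\<^sub>v N")
    case False
    have "(A *\<^sub>v x) $ 0 = (\<Sum>i\<in>{0..<N}. A $$ (0,i) * x $ i)"
      using A N by (auto simp: scalar_prod_def x_def)
    also have "\<dots> = (\<Sum>i\<in>{0,1}. A $$ (0,i) * x $ i)"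
      by (rule sum.mono_neutral_right) (use N in \<open>auto simp: x_def\<close>)
    also have "\<dots> = 0"
      using N by (simp add: x_def mult.commute)
    finally show ?thesis
      using False N by (intro *[of x]) (auto simp: x_def)
  next
    case True
    then have "x $ 1 = 0\<^sub>v N $ 1"
      by simp
    then have "A $$ (0,0) = 0"
      using N by (simp add: x_def)
    moreover have "unit_vec N 0 \<noteq> (0\<^sub>v N :: 'a vec)"
      using N by (metis index_unit_vec(2) index_zero_vec(1) less_le_trans zero_less_numeral zero_neq_one)
    ultimately show ?thesis
      using N A by (intro *[of "unit_vec N 0"]) auto
  qed
qed

text \<open>The row space is the image of the transposed generator matrix; the identity block
  reproduces the coefficients \<open>x\<close> themselves.\<close>

lemma append_cols_codeword:
  fixes M :: "'a::field mat"
  assumes M: "M \<in> carrier_mat N N" and x: "x \<in> carrier_vec N"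
  shows "x @\<^sub>v (M\<^sup>T *\<^sub>v x) \<in> vec_space.row_space (2 * N) (append_cols (1\<^sub>m N) M)"
proof -
  let ?G = "append_cols (1\<^sub>m N) M"
  have G: "?G \<in> carrier_mat N (2 * N)"
    using M unfolding append_cols_def by (auto simp: mult_2)
  have "?G\<^sup>T *\<^sub>v x = x @\<^sub>v (M\<^sup>T *\<^sub>v x)"
  proof (rule eq_vecI)
    fix i assume "i < dim_vec (x @\<^sub>v (M\<^sup>T *\<^sub>v x))"
    then have i: "i < N + N"
      using x M by simp
    have "col ?G i = (if i < N then unit_vec N i else col M (i - N))"
      using M i by (auto simp: append_cols_def intro!: eq_vecI)
    then show "(?G\<^sup>T *\<^sub>v x) $ i = (x @\<^sub>v (M\<^sup>T *\<^sub>v x)) $ i"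
      using G M x i by auto
  qed (use G M x in auto)
  moreover have "x @\<^sub>v (M\<^sup>T *\<^sub>v x) \<in> carrier_vec (2 * N)"
    using x M by (auto simp: mult_2)
  ultimately show ?thesis
    using G x by (auto simp: vec_space.row_space_eq[OF G])
qed

lemma min_dist_le:
  "u \<in> C \<Longrightarrow> v \<in> C \<Longrightarrow> u \<noteq> v \<Longrightarrow> min_dist C \<le> hamming_dist u v"
  unfolding min_dist_def by (rule Least_le) blast

text \<open>The codeword \<open>(x, 0)\<close> is at distance at most the weight of \<open>x\<close>
  from the zero codeword, and the minimum distance is \<open>2 * N - N = N\<close>. Hence
  \<open>x\<close> has full support.\<close>

lemma nmds_mat_transpose_kernel:
  fixes M :: "'a::field mat"
  assumes "nmds_mat N M" and x: "x \<in> carrier_vec N" "x \<noteq> 0\<^sub>v N" "M\<^sup>T *\<^sub>v x = 0\<^sub>v N" and "j < N"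
  shows "x $ j \<noteq> 0"
proof
  assume j: "x $ j = 0"
  let ?C = "vec_space.row_space (2 * N) (append_cols (1\<^sub>m N) M)"
  have M: "M \<in> carrier_mat N N" and "min_dist ?C = N"
    using assms(1) unfolding nmds_mat_def generator_mat_def nmds_code_def by auto
  have "M\<^sup>T *\<^sub>v 0\<^sub>v N = 0\<^sub>v N"
    using M by (intro eq_vecI) auto
  then have "x @\<^sub>v 0\<^sub>v N \<in> ?C" "0\<^sub>v N @\<^sub>v 0\<^sub>v N \<in> ?C"
    using append_cols_codeword[OF M x(1)] append_cols_codeword[OF M zero_carrier_vec] x(3)
    by auto
  moreover have "x @\<^sub>v 0\<^sub>v N \<noteq> 0\<^sub>v N @\<^sub>v 0\<^sub>v N"
    using x by (simp add: append_vec_eq)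
  ultimately have "N \<le> hamming_dist (x @\<^sub>v 0\<^sub>v N) (0\<^sub>v N @\<^sub>v 0\<^sub>v N)"
    using min_dist_le \<open>min_dist ?C = N\<close> by metis
  \<comment> \<open>The two words agree on the whole second half and, by assumption, at
    \<open>j\<close>.\<close>
  also have "\<dots> \<le> card ({..<N} - {j})"
    unfolding hamming_dist_def using x(1) j
    by (intro card_mono) (auto split: if_splits)
  also have "\<dots> < N"
    using \<open>j < N\<close> by simp
  finally show False
    by simp
qed

theorem theorem4:
  fixes M :: "'a::{field,finite} mat" and n r :: nat
  assumes "CARD('a) = 2 ^ r"
    and "n \<ge> 2"
    and "hadamard_mat n M"
    and "nmds_mat (2 ^ n) M"
  shows "invertible_mat M"
proof -
  have M: "M \<in> carrier_mat (2 ^ n) (2 ^ n)"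
    using assms(3) by (rule hadamard_mat_carrier)
  obtain c where c: "M * M = c \<cdot>\<^sub>m 1\<^sub>m (2 ^ n)"
    using hadamard_mat_square_scalar[OF char_two_if_card_power_two[OF assms(1)] assms(3)] ..
  have "c \<noteq> 0"
  proof
    assume "c = 0"
    then have "M * M = 0\<^sub>m (2 ^ n) (2 ^ n)"
      using c by (auto intro!: eq_matI)
    \<comment> \<open>Codewords combine rows of \<open>M\<close>, so the kernel vector is sought for
      the transpose.\<close>
    then have "M\<^sup>T * M\<^sup>T = 0\<^sub>m (2 ^ n) (2 ^ n)"
      using transpose_mult[OF M M] by simp
    moreover have "(2::nat) ^ n \<ge> 3"
      using power_increasing[OF assms(2), of "2::nat"] by simp
    ultimately show False
      using square_zero_mat_kernel[of "M\<^sup>T" "2 ^ n"] nmds_mat_transpose_kernel[OF assms(4)] M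
      by (metis transpose_carrier_mat)
  qed
  then show ?thesis
    using invertible_mat_if_square_scalar M c by blast
qed

end
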